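(* Consider the problem $F^*=\min_{x\in\mathrm{dom}\,\psi}[F(x)=f(x)+\psi(x)]$, where $\psi$ is a closed convex function and $f$ is a convex function which is Q-regular on a convex set $S\supseteq\mathrm{dom}\,\psi$ with parameters $0$ and $L$ with respect to a Euclidean norm $\|\cdot\|$. Let $x_0\in\mathrm{dom}\,\psi$ with $F(x_0)>F^*$, let $x^*$ be an optimal solution, let $R>0$ be such that $\|x_0-x^*\|\le R$, and let $\epsilon>0$. Put $$H=\frac{12\,\epsilon}{R^4},\qquad F_{x_0,H}(x)=F(x)+\frac{H}{24}\|x-x_0\|^4,\quad x\in\mathrm{dom}\,\psi .$$ Apply the Quartic Regularization of Newton Method (described in the context), started at $x_0$, to the minimization of $F_{x_0,H}$ over $\mathrm{dom}\,\psi$, with smooth part $f+\frac H{24}\|\cdot-x_0\|^4$, Q-regularity parameters $\mu_\epsilon=H$, $L_\epsilon=L+H$ (so that $q_\epsilon=\mu_\epsilon/L_\epsilon$ satisfies $q_\epsilon^{-1}=1+\frac{LR^4}{12\epsilon}$), and $\gamma=\frac{1}{3\left(1-\frac{3}{11}q_\epsilon^{1/3}\right)}$. Then it needs at most $$\frac{22}{3}\left[1+\frac{LR^4}{12\epsilon}\right]^{1/3}\ln\frac{2(F(x_0)-F^* )}{\epsilon}$$ iterations to find an $(\epsilon/2)$-solution $\bar x$ of the regularized problem, i.e. a point $\bar x \in \mathrm{dom}\,\psi$ with $F_{x_0,H}(\bar x)-\min_{\mathrm{dom}\,\psi}F_{x_0,H}\le\epsilon/2$, and any such point satisfies $F(\bar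 x)-F^*\le\epsilon$.
   Context: $\mathbb{E}$ is a finite-dimensional real vector space with dual pairing $\langle\cdot,\cdot\rangle$; $\|x\|=\langle Bx,x\rangle^{1/2}$ for a fixed self-adjoint positive definite operator $B:\mathbb{E}\to\mathbb{E}^*$. A function $f$ with convex open domain $\mathrm{dom}\,f\subseteq\mathbb{E}$ is called quartic regular (Q-regular) on a convex set $S$ with parameters $\mu$ and $L$, $L\ge\mu\ge0$, if $f$ is four times continuously differentiable on $\mathrm{dom}\,f$, $S_{1/2}:=\{x-\frac12(y-x):x,y\in S\}\subseteq\mathrm{dom}\,f$, and $$D^4f(x)[h]^4\ge\mu\|h\|^4\quad\forall h\in\mathbb{E},\ x\in S,\qquad D^4f(x)[h]^4\le L\|h\|^4\quad\forall h\in\mathbb{E},\ x\in S_{1/2}.$$ Quartic Regularization of Newton Method for minimizing $g+\psi$ over $\mathrm{dom}\,\psi$, with $g$ convex and Q-regular on $S\supseteq\mathrm{dom}\,\psi$ with parameters $\mu_g,L_g$ and with parameter $\gamma>0$: starting from $x_0\in\mathrm{dom}\,\psi$, for $k\ge0$ let $x_{k+1}$ be a minimizer over $y\in\mathrm{dom}\,\psi$ of $$g(x_k)+\langle\nabla g(x_k),y-x_k\rangle+\frac{1+3\gamma}{6\gamma}\langle\nabla^2g(x_k)(y-x_k),y-x_k\rangle+\frac{1+2\gamma}{24}L_g\|y-x_k\|^4+\psi(y).$$ *)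

theory Defs
  imports "HOL-Analysis.Analysis"
begin

text \<open>The Euclidean norm given by an operator \<open>B : E \<rightarrow> E*\<close>. The dual space is
  \<open>'a \<Rightarrow>\<^sub>L real\<close> and the dual pairing is application. The norm that the type \<open>'a\<close> carries
  provides the topology only.\<close>

definition self_adjoint_pos_def :: "('a::euclidean_space \<Rightarrow>\<^sub>L 'a \<Rightarrow>\<^sub>L real) \<Rightarrow> bool" where
  "self_adjoint_pos_def B \<longleftrightarrow>
     (\<forall>x y. blinfun_apply (B x) y = B y x) \<and> (\<forall>x. x \<noteq> 0 \<longrightarrow> blinfun_apply (B x) x > 0)"

definition norm_of :: "('a::euclidean_space \<Rightarrow>\<^sub>L 'a \<Rightarrow>\<^sub>L real) \<Rightarrow> 'a \<Rightarrow> real" where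
  "norm_of B x = sqrt (blinfun_apply (B x) x)"

text \<open>The Frechet derivative as a map into bounded linear operators, so that it can be iterated.
  Only its values at points of differentiability are meaningful.\<close>

definition fderiv :: "('a::real_normed_vector \<Rightarrow> 'b::real_normed_vector) \<Rightarrow> 'a \<Rightarrow> 'a \<Rightarrow>\<^sub>L 'b" where
  "fderiv f x = Blinfun (frechet_derivative f (at x))"

definition C4_on :: "'a::euclidean_space set \<Rightarrow> ('a \<Rightarrow> real) \<Rightarrow> bool" where
  "C4_on D f \<longleftrightarrow>
     (\<forall>x\<in>D. f differentiable (at x)
           \<and> fderiv f differentiable (at x)
           \<and> fderiv (fderiv f) differentiable (at x)
           \<and> fderiv (fderiv (fderiv f)) differentiable (at x))
     \<and> continuous_on D (fderiv (fderiv (fderiv (fderiv f))))"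

definition D4 :: "('a::euclidean_space \<Rightarrow> real) \<Rightarrow> 'a \<Rightarrow> 'a \<Rightarrow> real" where
  "D4 f x h = blinfun_apply (fderiv (fderiv (fderiv (fderiv f))) x h h h) h"

definition half_extension :: "'a::real_vector set \<Rightarrow> 'a set" where
  "half_extension S = {x - (1/2) *\<^sub>R (y - x) | x y. x \<in> S \<and> y \<in> S}"

text \<open>\<open>D\<close> is the domain of \<open>f\<close>; values of \<open>f\<close> outside \<open>D\<close> are irrelevant.\<close>

definition Q_regular ::
  "('a::euclidean_space \<Rightarrow>\<^sub>L 'a \<Rightarrow>\<^sub>L real) \<Rightarrow> 'a set \<Rightarrow> ('a \<Rightarrow> real) \<Rightarrow> 'a set \<Rightarrow> real \<Rightarrow> real \<Rightarrow> bool" where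
  "Q_regular B D f S \<mu> L \<longleftrightarrow>
     open D \<and> convex D \<and> convex S \<and> 0 \<le> \<mu> \<and> \<mu> \<le> L
     \<and> C4_on D f \<and> half_extension S \<subseteq> D
     \<and> (\<forall>x\<in>S. \<forall>h. D4 f x h \<ge> \<mu> * norm_of B h ^ 4)
     \<and> (\<forall>x\<in>half_extension S. \<forall>h. D4 f x h \<le> L * norm_of B h ^ 4)"

text \<open>A closed convex function \<open>\<psi> : E \<rightarrow> \<real> \<union> {+\<infinity>}\<close> is given by its effective domain \<open>P\<close> and its
  finite values on \<open>P\<close>; closedness means that its epigraph is closed, and \<open>P\<close> itself need not be.\<close>

definition closed_convex_fun :: "'a::euclidean_space set \<Rightarrow> ('a \<Rightarrow> real) \<Rightarrow> bool" where
  "closed_convex_fun P \<psi> \<longleftrightarrow> convex_on P \<psi> \<and> closed (epigraph P \<psi>)"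

definition quartic_model ::
  "('a::euclidean_space \<Rightarrow>\<^sub>L 'a \<Rightarrow>\<^sub>L real) \<Rightarrow> ('a \<Rightarrow> real) \<Rightarrow> ('a \<Rightarrow> real) \<Rightarrow> real \<Rightarrow> real \<Rightarrow> 'a \<Rightarrow> 'a \<Rightarrow> real" where
  "quartic_model B g \<psi> L \<gamma> x y =
     g x + blinfun_apply (fderiv g x) (y - x)
     + (1 + 3 * \<gamma>) / (6 * \<gamma>) * blinfun_apply (fderiv (fderiv g) x (y - x)) (y - x)
     + (1 + 2 * \<gamma>) / 24 * L * norm_of B (y - x) ^ 4 + \<psi> y"

definition quartic_newton_run ::
  "('a::euclidean_space \<Rightarrow>\<^sub>L 'a \<Rightarrow>\<^sub>L real) \<Rightarrow> ('a \<Rightarrow> real) \<Rightarrow> 'a set \<Rightarrow> ('a \<Rightarrow> real) \<Rightarrow> real \<Rightarrow> real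
     \<Rightarrow> 'a \<Rightarrow> (nat \<Rightarrow> 'a) \<Rightarrow> bool" where
  "quartic_newton_run B g P \<psi> L \<gamma> x\<^sub>0 x \<longleftrightarrow>
     x 0 = x\<^sub>0 \<and> x\<^sub>0 \<in> P
     \<and> (\<forall>k. is_arg_min (quartic_model B g \<psi> L \<gamma> (x k)) (\<lambda>y. y \<in> P) (x (Suc k)))"

end

theory Submission
  imports Defs
begin

text \<open>Write \<open>\<alpha> = (3/22) q\<^sup>1\<^sup>/\<^sup>3\<close>, so that \<open>\<gamma> = 1 / (3 (1 - 2 \<alpha>))\<close>. The point of the
  proof is that one step of the method shrinks the gap \<open>F\<^sub>H(x\<^sub>k) - min F\<^sub>H\<close> by the factor
  \<open>1 - \<alpha>\<close> (\<open>newton_step_contraction\<close>). As \<open>F\<^sub>H\<close> agrees with \<open>F\<close> at \<open>x\<^sub>0\<close> and dominates it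
  elsewhere, the initial gap is at most \<open>F(x\<^sub>0) - F\<^sup>*\<close>, and \<open>(1 - \<alpha>)\<^sup>k \<le> exp (- \<alpha> k)\<close> gives the
  iteration count \<open>(1 / \<alpha>) ln (2 (F(x\<^sub>0) - F\<^sup>*) / \<epsilon>)\<close>. The value of \<open>H\<close> is such that the
  regularizer costs at most \<open>\<epsilon> / 2\<close> at \<open>x\<^sup>*\<close>, which leaves \<open>\<epsilon> / 2\<close> for the accuracy of \<open>xbar\<close>.

  The contraction compares the model with \<open>g + \<psi>\<close> along two segments that start at \<open>x\<^sub>k\<close>, so it is
  a statement about the function \<open>\<phi> t = g (x + t h)\<close> on \<open>[-1/2, 1]\<close>. Its second derivative \<open>u\<close> is
  nonnegative because \<open>g\<close> is convex, and \<open>u''\<close> lies between \<open>m\<close> and \<open>M\<close>, the multiples of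
  \<open>\<parallel>h\<parallel>\<^sup>4\<close> given by Q-regularity. Two estimates are needed.

  \<^item> The model majorizes \<open>g + \<psi>\<close> (\<open>quartic_upper_model\<close>): since \<open>u\<close> stays nonnegative on the
    backward extension of the segment, its slope at \<open>0\<close> cannot be large.
  \<^item> The model at \<open>x + \<alpha> (z - x)\<close>, with \<open>z\<close> the minimizer of \<open>F\<^sub>H\<close>, is at most the convex
    combination of the values of \<open>g + \<psi>\<close> at \<open>x\<close> and \<open>z\<close> (\<open>interpolated_model\<close>). This requires a
    lower bound of \<open>\<phi> 1 - \<phi> 0 - \<phi>' 0 = \<integral>\<^sub>0\<^sup>1 (1 - t) u t dt\<close> by a multiple of \<open>u 0\<close> and a
    multiple of \<open>m\<close>. The integral is cut at \<open>\<tau> = 2 \<alpha>\<close>: the error bound of the trapezoidal rule on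
    \<open>[0, \<tau>]\<close> pays for \<open>u 0\<close> up to a loss of order \<open>M \<tau>\<^sup>3\<close>, and the uniform convexity \<open>u'' \<ge> m\<close> on
    \<open>[\<tau>, 1]\<close> pays for this loss, because \<open>M \<alpha>\<^sup>3\<close> is a multiple of \<open>m\<close>. This balance is the origin
    of the exponent \<open>1/3\<close>.

  That \<open>g\<close> is again Q-regular follows from \<open>\<parallel>x\<parallel>\<^sup>4 = T x x x x\<close> for a symmetric tensor \<open>T\<close>, whose
  derivatives are immediate. The minimizer exists because \<open>F\<^sub>H\<close> grows like \<open>\<parallel>x - x\<^sub>0\<parallel>\<^sup>4\<close> and the
  epigraph of \<open>\<psi>\<close> is closed.\<close>

section \<open>Convex functions of one variable with bounded fourth derivative\<close>

lemma taylor_comparison: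
  fixes u p :: "real \<Rightarrow> real"
  assumes "a \<le> b"
    and u: "\<And>t. t \<in> {a..b} \<Longrightarrow> (u has_real_derivative u1 t) (at t)"
      "\<And>t. t \<in> {a..b} \<Longrightarrow> (u1 has_real_derivative u2 t) (at t)"
    and p: "\<And>t. t \<in> {a..b} \<Longrightarrow> (p has_real_derivative p1 t) (at t)"
      "\<And>t. t \<in> {a..b} \<Longrightarrow> (p1 has_real_derivative p2 t) (at t)"
    and le: "\<And>t. t \<in> {a..b} \<Longrightarrow> p2 t \<le> u2 t"
  shows "p b - p a - p1 a * (b - a) \<le> u b - u a - u1 a * (b - a)"
proof -
  have "(u1 a - p1 a) * (b - a) \<le> (u b - p b) - (u a - p a)"
    by (rule f''_imp_f'[where C = "{a..b}" and f'' = "\<lambda>t. u2 t - p2 t"])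
       (use assms in \<open>auto intro!: DERIV_diff\<close>)
  then show ?thesis
    by (simp add: algebra_simps)
qed

text \<open>The function \<open>t \<mapsto> g (x + t (y - x))\<close>, for \<open>x\<close> and \<open>y\<close> in the set of Q-regularity. The left end
  \<open>-1/2\<close> corresponds to the half extension of this set, where only the upper bound of the fourth
  derivative is available.\<close>

locale quartic_profile =
  fixes \<phi> \<phi>1 \<phi>2 \<phi>3 \<phi>4 :: "real \<Rightarrow> real" and m M :: real
  assumes d0: "t \<in> {-1/2..1} \<Longrightarrow> (\<phi> has_real_derivative \<phi>1 t) (at t)"
    and d1: "t \<in> {-1/2..1} \<Longrightarrow> (\<phi>1 has_real_derivative \<phi>2 t) (at t)"
    and d2: "t \<in> {-1/2..1} \<Longrightarrow> (\<phi>2 has_real_derivative \<phi>3 t) (at t)"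
    and d3: "t \<in> {-1/2..1} \<Longrightarrow> (\<phi>3 has_real_derivative \<phi>4 t) (at t)"
    and nonneg: "t \<in> {-1/2..1} \<Longrightarrow> 0 \<le> \<phi>2 t"
    and upper: "t \<in> {-1/2..1} \<Longrightarrow> \<phi>4 t \<le> M"
    and lower: "t \<in> {0..1} \<Longrightarrow> m \<le> \<phi>4 t"
begin

lemma concave: "concave_on {-1/2..1} (\<lambda>t. \<phi>2 t - M * t\<^sup>2 / 2)"
proof (rule f''_le0_imp_concave)
  fix t :: real assume t: "t \<in> {-1/2..1}"
  show "((\<lambda>t. \<phi>2 t - M * t\<^sup>2 / 2) has_real_derivative \<phi>3 t - M * t) (at t)"
    by (auto intro!: derivative_eq_intros d2[OF t])
  show "((\<lambda>t. \<phi>3 t - M * t) has_real_derivative \<phi>4 t - M) (at t)"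
    by (auto intro!: derivative_eq_intros d3[OF t])
  show "\<phi>4 t - M \<le> 0"
    using upper[OF t] by simp
qed simp

lemma concaveD:
  assumes "a \<in> {-1/2..1}" "b \<in> {-1/2..1}" "0 \<le> w" "w \<le> 1" "c = (1 - w) * a + w * b"
  shows "(1 - w) * (\<phi>2 a - M * a\<^sup>2 / 2) + w * (\<phi>2 b - M * b\<^sup>2 / 2) \<le> \<phi>2 c - M * c\<^sup>2 / 2"
proof -
  have "- (\<phi>2 ((1 - w) *\<^sub>R a + w *\<^sub>R b) - M * ((1 - w) *\<^sub>R a + w *\<^sub>R b)\<^sup>2 / 2)
      \<le> (1 - w) * (- (\<phi>2 a - M * a\<^sup>2 / 2)) + w * (- (\<phi>2 b - M * b\<^sup>2 / 2))"
    by (rule convex_onD[OF concave[unfolded concave_on_def]]) (use assms in auto)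
  then show ?thesis
    unfolding assms(5) real_scaleR_def mult_minus_right by linarith
qed

text \<open>The function \<open>\<phi>2 t - M t\<^sup>2 / 2\<close> is concave, so its value at \<open>t\<close> is bounded by extrapolation from its
  values at \<open>-\<gamma>\<close> and \<open>0\<close>, and at \<open>-\<gamma>\<close> the nonnegativity of \<open>\<phi>2\<close> replaces the unknown value.
  Integrating twice gives exactly the coefficients of the method; \<open>\<gamma> \<le> 1/2\<close> keeps \<open>-\<gamma>\<close> in range.\<close>

lemma quartic_upper_model:
  assumes \<gamma>: "0 < \<gamma>" "\<gamma> \<le> 1/2"
  shows "\<phi> 1 \<le> \<phi> 0 + \<phi>1 0 + (1 + 3 * \<gamma>) / (6 * \<gamma>) * \<phi>2 0 + (1 + 2 * \<gamma>) / 24 * M"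
proof -
  define s where "s = \<phi>2 0"
  have bound: "\<phi>2 t \<le> (1 + t / \<gamma>) * s + M * (t * \<gamma> / 2 + t\<^sup>2 / 2)" if t: "t \<in> {0..1}" for t
  proof -
    define w where "w = \<gamma> / (t + \<gamma>)"
    have pos: "t + \<gamma> > 0" using t \<gamma> by auto
    have w: "0 \<le> w" "w \<le> 1" "0 = (1 - w) * (-\<gamma>) + w * t"
      using t \<gamma> pos by (auto simp: w_def field_simps)
    have "(1 - w) * (\<phi>2 (-\<gamma>) - M * (-\<gamma>)\<^sup>2 / 2) + w * (\<phi>2 t - M * t\<^sup>2 / 2) \<le> s"
      using concaveD[OF _ _ w] t \<gamma> by (simp add: s_def)
    moreover have "0 \<le> (1 - w) * \<phi>2 (-\<gamma>)"
      using w nonneg[of "-\<gamma>"] \<gamma> by auto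
    ultimately have "(1 - w) * (- M * \<gamma>\<^sup>2 / 2) + w * (\<phi>2 t - M * t\<^sup>2 / 2) \<le> s"
      by (simp add: algebra_simps)
    then have "(t + \<gamma>) * ((1 - w) * (- M * \<gamma>\<^sup>2 / 2) + w * (\<phi>2 t - M * t\<^sup>2 / 2)) \<le> (t + \<gamma>) * s"
      using pos by simp
    moreover have "(t + \<gamma>) * (1 - w) = t" "(t + \<gamma>) * w = \<gamma>"
      using pos by (auto simp: w_def field_simps)
    ultimately have "t * (- M * \<gamma>\<^sup>2 / 2) + \<gamma> * (\<phi>2 t - M * t\<^sup>2 / 2) \<le> (t + \<gamma>) * s"
      by (metis (no_types, opaque_lifting) distrib_left mult.assoc)
    then have "\<gamma> * \<phi>2 t \<le> (t + \<gamma>) * s + \<gamma> * (M * (t * \<gamma> / 2 + t\<^sup>2 / 2))"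
      by (simp add: algebra_simps power2_eq_square)
    also have "(t + \<gamma>) * s = \<gamma> * ((1 + t / \<gamma>) * s)"
      using \<gamma> by (simp add: field_simps)
    finally have "\<gamma> * \<phi>2 t \<le> \<gamma> * ((1 + t / \<gamma>) * s + M * (t * \<gamma> / 2 + t\<^sup>2 / 2))"
      by (simp add: distrib_left)
    then show ?thesis
      using \<gamma> by simp
  qed
  define p where "p t = (t\<^sup>2 / 2 + t ^ 3 / (6 * \<gamma>)) * s + M * (t ^ 3 * \<gamma> / 12 + t ^ 4 / 24)" for t
  define p1 where "p1 t = (t + t\<^sup>2 / (2 * \<gamma>)) * s + M * (t\<^sup>2 * \<gamma> / 4 + t ^ 3 / 6)" for t
  have "\<phi> 1 - \<phi> 0 - \<phi>1 0 * (1 - 0) \<le> p 1 - p 0 - p1 0 * (1 - 0)"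
  proof (rule taylor_comparison[where ?p1.0 = \<phi>1 and ?p2.0 = \<phi>2 and ?u1.0 = p1
        and ?u2.0 = "\<lambda>t. (1 + t / \<gamma>) * s + M * (t * \<gamma> / 2 + t\<^sup>2 / 2)"])
    fix t :: real assume t: "t \<in> {0..1}"
    show "(p has_real_derivative p1 t) (at t)"
      unfolding p_def[abs_def] p1_def
      using \<gamma> by (auto intro!: derivative_eq_intros simp: field_simps)
    show "(p1 has_real_derivative (1 + t / \<gamma>) * s + M * (t * \<gamma> / 2 + t\<^sup>2 / 2)) (at t)"
      unfolding p1_def[abs_def]
      using \<gamma> by (auto intro!: derivative_eq_intros simp: field_simps power2_eq_square)
  qed (use bound d0 d1 in auto)
  then show ?thesis
    using \<gamma> by (simp add: p_def p1_def s_def field_simps)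
qed

text \<open>The same concavity between \<open>0\<close> and \<open>\<tau>\<close> bounds \<open>\<phi>2\<close> from below by its chord minus the
  error term \<open>M t (\<tau> - t) / 2\<close> of linear interpolation; in the chord the value at \<open>\<tau>\<close> is dropped.\<close>

lemma trapezoid:
  assumes \<tau>: "0 < \<tau>" "\<tau> \<le> 1"
  shows "\<phi> \<tau> - \<phi> 0 - \<tau> * \<phi>1 0 \<ge> \<tau>\<^sup>2 / 3 * \<phi>2 0 - M * \<tau> ^ 4 / 24"
    and "\<phi>1 \<tau> - \<phi>1 0 \<ge> \<tau> / 2 * \<phi>2 0 - M * \<tau> ^ 3 / 12"
proof -
  define s where "s = \<phi>2 0"
  have bound: "(1 - t / \<tau>) * s - M * (t * (\<tau> - t) / 2) \<le> \<phi>2 t" if t: "t \<in> {0..\<tau>}" for t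
  proof -
    have "(1 - t / \<tau>) * (\<phi>2 0 - M * 0\<^sup>2 / 2) + t / \<tau> * (\<phi>2 \<tau> - M * \<tau>\<^sup>2 / 2) \<le> \<phi>2 t - M * t\<^sup>2 / 2"
      by (rule concaveD) (use t \<tau> in auto)
    moreover have "0 \<le> t / \<tau> * \<phi>2 \<tau>"
      using t \<tau> nonneg[of \<tau>] by auto
    ultimately have "(1 - t / \<tau>) * s - t / \<tau> * (M * \<tau>\<^sup>2 / 2) \<le> \<phi>2 t - M * t\<^sup>2 / 2"
      by (simp add: s_def right_diff_distrib)
    moreover have "t / \<tau> * (M * \<tau>\<^sup>2 / 2) = M * (t * \<tau> / 2)"
      using \<tau> by (simp add: power2_eq_square)
    ultimately have "(1 - t / \<tau>) * s - M * (t * \<tau> / 2) \<le> \<phi>2 t - M * t\<^sup>2 / 2"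
      by simp
    moreover have "M * (t * (\<tau> - t) / 2) = M * (t * \<tau> / 2) - M * t\<^sup>2 / 2"
      by (simp add: field_simps power2_eq_square)
    ultimately show ?thesis
      by linarith
  qed
  \<comment> \<open>the first two antiderivatives of the lower bound\<close>
  define p where "p t = (t\<^sup>2 / 2 - t ^ 3 / (6 * \<tau>)) * s - M * (\<tau> * t ^ 3 / 12 - t ^ 4 / 24)" for t
  define p1 where "p1 t = (t - t\<^sup>2 / (2 * \<tau>)) * s - M * (\<tau> * t\<^sup>2 / 4 - t ^ 3 / 6)" for t
  define p2 where "p2 t = (1 - t / \<tau>) * s - M * (t * (\<tau> - t) / 2)" for t
  have dp: "(p has_real_derivative p1 t) (at t)" for t
    unfolding p_def[abs_def] p1_def
    using \<tau> by (auto intro!: derivative_eq_intros simp: field_simps)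
  have dp1: "(p1 has_real_derivative p2 t) (at t)" for t
    unfolding p1_def[abs_def] p2_def
    using \<tau> by (auto intro!: derivative_eq_intros simp: field_simps power2_eq_square)
  have "p \<tau> - p 0 - p1 0 * (\<tau> - 0) \<le> \<phi> \<tau> - \<phi> 0 - \<phi>1 0 * (\<tau> - 0)"
    by (rule taylor_comparison[where ?p1.0 = p1 and ?p2.0 = p2 and ?u1.0 = \<phi>1 and ?u2.0 = \<phi>2])
       (use \<tau> bound dp dp1 d0 d1 in \<open>auto simp: p2_def\<close>)
  then show "\<phi> \<tau> - \<phi> 0 - \<tau> * \<phi>1 0 \<ge> \<tau>\<^sup>2 / 3 * \<phi>2 0 - M * \<tau> ^ 4 / 24"
    using \<tau> by (simp add: p_def p1_def s_def field_simps power2_eq_square power3_eq_cube power4_eq_xxxx)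
  have "\<phi>1 0 - p1 0 \<le> \<phi>1 \<tau> - p1 \<tau>"
  proof (rule DERIV_nonneg_imp_nondecreasing[where f = "\<lambda>t. \<phi>1 t - p1 t"])
    fix t assume t: "0 \<le> t" "t \<le> \<tau>"
    have "((\<lambda>t. \<phi>1 t - p1 t) has_real_derivative \<phi>2 t - p2 t) (at t)"
      using t \<tau> by (intro DERIV_diff d1 dp1) auto
    moreover have "0 \<le> \<phi>2 t - p2 t"
      using bound[of t] t by (simp add: p2_def)
    ultimately show "\<exists>y. ((\<lambda>t. \<phi>1 t - p1 t) has_real_derivative y) (at t) \<and> 0 \<le> y"
      by blast
  qed (use \<tau> in auto)
  then show "\<phi>1 \<tau> - \<phi>1 0 \<ge> \<tau> / 2 * \<phi>2 0 - M * \<tau> ^ 3 / 12"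
    using \<tau> by (simp add: p1_def s_def field_simps power2_eq_square power3_eq_cube)
qed

text \<open>For the weight \<open>1 - t\<close> on \<open>[\<tau>, 1]\<close> the one-point Gauss rule has its node \<open>c\<close> at one third of
  the interval. Expanding \<open>\<phi>2\<close> around this node, the linear term integrates to zero, the constant
  term is nonnegative, and the quadratic term is at least \<open>m (t - c)\<^sup>2 / 2\<close>.\<close>

lemma uniform_convexity:
  assumes \<tau>: "0 \<le> \<tau>" "\<tau> \<le> 1"
  shows "\<phi> 1 - \<phi> \<tau> - (1 - \<tau>) * \<phi>1 \<tau> \<ge> m * (1 - \<tau>) ^ 4 / 72"
proof -
  define l where "l = (1 - \<tau>) / 3"
  define c where "c = \<tau> + l"
  have \<tau>_eq: "\<tau> = 1 - 3 * l" "c = 1 - 2 * l" "0 \<le> l" "l \<le> 1/3"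
    using \<tau> by (auto simp: l_def c_def field_simps)
  have bound: "\<phi>3 c * (t - c) + m * (t - c)\<^sup>2 / 2 \<le> \<phi>2 t" if t: "t \<in> {\<tau>..1}" for t
  proof -
    have "(\<phi>3 c - m * (c - c)) * (t - c)
        \<le> (\<phi>2 t - m * (t - c)\<^sup>2 / 2) - (\<phi>2 c - m * (c - c)\<^sup>2 / 2)"
    proof (rule f''_imp_f'[where C = "{0..1}" and f = "\<lambda>t. \<phi>2 t - m * (t - c)\<^sup>2 / 2"
          and f' = "\<lambda>t. \<phi>3 t - m * (t - c)" and f'' = "\<lambda>t. \<phi>4 t - m"])
      fix x :: real assume x: "x \<in> {0..1}"
      show "((\<lambda>t. \<phi>2 t - m * (t - c)\<^sup>2 / 2) has_real_derivative \<phi>3 x - m * (x - c)) (at x)"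
        using x by (auto intro!: derivative_eq_intros d2)
      show "((\<lambda>t. \<phi>3 t - m * (t - c)) has_real_derivative \<phi>4 x - m) (at x)"
        using x by (auto intro!: derivative_eq_intros d3)
      show "0 \<le> \<phi>4 x - m"
        using lower[OF x] by simp
    qed (use t \<tau>_eq in auto)
    moreover have "0 \<le> \<phi>2 c"
      using \<tau>_eq by (intro nonneg) auto
    ultimately show ?thesis by simp
  qed
  define p where "p t = \<phi>3 c * (t - c) ^ 3 / 6 + m * (t - c) ^ 4 / 24" for t
  define p1 where "p1 t = \<phi>3 c * (t - c)\<^sup>2 / 2 + m * (t - c) ^ 3 / 6" for t
  have "p 1 - p \<tau> - p1 \<tau> * (1 - \<tau>) \<le> \<phi> 1 - \<phi> \<tau> - \<phi>1 \<tau> * (1 - \<tau>)"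
  proof (rule taylor_comparison[where ?u1.0 = \<phi>1 and ?u2.0 = \<phi>2 and ?p1.0 = p1
        and ?p2.0 = "\<lambda>t. \<phi>3 c * (t - c) + m * (t - c)\<^sup>2 / 2"])
    fix t
    show "(p has_real_derivative p1 t) (at t)"
      unfolding p_def[abs_def] p1_def
      by (auto intro!: derivative_eq_intros simp: field_simps)
    show "(p1 has_real_derivative \<phi>3 c * (t - c) + m * (t - c)\<^sup>2 / 2) (at t)"
      unfolding p1_def[abs_def]
      by (auto intro!: derivative_eq_intros simp: field_simps power2_eq_square)
  qed (use \<tau> bound d0 d1 in auto)
  moreover have "p 1 - p \<tau> - p1 \<tau> * (1 - \<tau>) = m * (1 - \<tau>) ^ 4 / 72"
    unfolding p_def p1_def \<tau>_eq by (simp add: field_simps power2_eq_square power3_eq_cube power4_eq_xxxx)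
  ultimately show ?thesis
    by (simp add: mult.commute)
qed

text \<open>Dividing by \<open>\<alpha>\<close>, the claim is that \<open>\<alpha> (1 - \<alpha>) \<phi>2 0\<close> plus a small multiple of \<open>m\<close> is at most
  \<open>\<phi> 1 - \<phi> 0 - \<phi>1 0\<close>. With the split point \<open>\<tau> = 2 \<alpha>\<close> the trapezoidal bound has the
  coefficient \<open>\<tau> / 2 - \<tau>\<^sup>2 / 6 = \<alpha> (1 - 2 \<alpha> / 3)\<close> of \<open>\<phi>2 0\<close>, which suffices. The constant \<open>3/22\<close> is small enough that the losses, at most
  \<open>(2/3 + 23/288) (3/22)\<^sup>3 m\<close>, stay below the gain \<open>(8/11)\<^sup>4 m / 72\<close>.\<close>

lemma interpolated_model:
  assumes \<alpha>: "0 < \<alpha>" "\<alpha> \<le> 3/22" and m: "0 \<le> m" and M: "M * \<alpha> ^ 3 = (3/22) ^ 3 * m"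
    and \<gamma>: "\<gamma> = 1 / (3 * (1 - 2 * \<alpha>))"
  shows "\<phi> 0 + \<alpha> * \<phi>1 0 + (1 + 3 * \<gamma>) / (6 * \<gamma>) * (\<alpha>\<^sup>2 * \<phi>2 0)
      + (1 + 2 * \<gamma>) / 24 * (M * \<alpha> ^ 4) \<le> (1 - \<alpha>) * \<phi> 0 + \<alpha> * \<phi> 1"
proof -
  define \<tau> where "\<tau> = 2 * \<alpha>"
  have \<tau>: "0 < \<tau>" "\<tau> \<le> 3/11"
    using \<alpha> by (auto simp: \<tau>_def)
  have s: "0 \<le> \<phi>2 0"
    by (rule nonneg) auto
  have coeff: "(1 + 3 * \<gamma>) / (6 * \<gamma>) = 1 - \<alpha>"
    using \<alpha> by (simp add: \<gamma> field_simps)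
  have "\<gamma> \<le> 11/24"
    using \<alpha> by (simp add: \<gamma> field_simps)
  then have quart: "(1 + 2 * \<gamma>) / 24 * ((3/22) ^ 3 * m) \<le> 23/288 * ((3/22) ^ 3 * m)"
    using m by (intro mult_right_mono) auto
  \<comment> \<open>cutting the integral of \<open>(1 - t) * \<phi>2 t\<close> at \<open>\<tau>\<close>\<close>
  have "\<phi> 1 - \<phi> 0 - \<phi>1 0 = (\<phi> 1 - \<phi> \<tau> - (1 - \<tau>) * \<phi>1 \<tau>) + (\<phi> \<tau> - \<phi> 0 - \<tau> * \<phi>1 0)
      + (1 - \<tau>) * (\<phi>1 \<tau> - \<phi>1 0)"
    by (simp add: algebra_simps)
  also have "\<dots> \<ge> m * (1 - \<tau>) ^ 4 / 72 + (\<tau>\<^sup>2 / 3 * \<phi>2 0 - M * \<tau> ^ 4 / 24)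
      + (1 - \<tau>) * (\<tau> / 2 * \<phi>2 0 - M * \<tau> ^ 3 / 12)"
    using \<tau> by (intro add_mono mult_left_mono uniform_convexity trapezoid) auto
  also have "m * (1 - \<tau>) ^ 4 / 72 + (\<tau>\<^sup>2 / 3 * \<phi>2 0 - M * \<tau> ^ 4 / 24)
      + (1 - \<tau>) * (\<tau> / 2 * \<phi>2 0 - M * \<tau> ^ 3 / 12)
      = m * (1 - \<tau>) ^ 4 / 72 + \<alpha> * (1 - 2 * \<alpha> / 3) * \<phi>2 0 - (1 - \<alpha>) * 2 / 3 * (M * \<alpha> ^ 3)"
    by (simp add: \<tau>_def field_simps power2_eq_square power3_eq_cube power4_eq_xxxx)
  finally have main: "m * (1 - \<tau>) ^ 4 / 72 + \<alpha> * (1 - 2 * \<alpha> / 3) * \<phi>2 0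
      - (1 - \<alpha>) * 2 / 3 * ((3/22) ^ 3 * m) \<le> \<phi> 1 - \<phi> 0 - \<phi>1 0"
    unfolding M .
  have "\<alpha> * (1 - \<alpha>) * \<phi>2 0 \<le> \<alpha> * (1 - 2 * \<alpha> / 3) * \<phi>2 0"
    using \<alpha> s by (intro mult_right_mono mult_left_mono) auto
  moreover have "(8/11) ^ 4 \<le> (1 - \<tau>) ^ 4"
    using \<tau> by (intro power_mono) auto
  then have "m * (8/11) ^ 4 \<le> m * (1 - \<tau>) ^ 4"
    using m by (rule mult_left_mono)
  moreover have "(1 - \<alpha>) * 2 / 3 * ((3/22) ^ 3 * m) \<le> 2 / 3 * ((3/22) ^ 3 * m)"
    using m \<alpha> by (intro mult_right_mono) auto
  moreover have numerics: "(8/11 :: real) ^ 4 = 4096/14641" "(3/22 :: real) ^ 3 = 27/10648"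
    by (auto simp: power_divide)
  ultimately have "\<alpha> * (1 - \<alpha>) * \<phi>2 0 + (1 + 2 * \<gamma>) / 24 * ((3/22) ^ 3 * m) \<le> \<phi> 1 - \<phi> 0 - \<phi>1 0"
    using main quart m unfolding numerics by linarith
  then have "\<alpha> * (\<alpha> * (1 - \<alpha>) * \<phi>2 0 + (1 + 2 * \<gamma>) / 24 * (M * \<alpha> ^ 3)) \<le> \<alpha> * (\<phi> 1 - \<phi> 0 - \<phi>1 0)"
    unfolding M using \<alpha> by (intro mult_left_mono) auto
  then show ?thesis
    unfolding coeff by (simp add: algebra_simps power2_eq_square power3_eq_cube power4_eq_xxxx)
qed

end

section \<open>Iterated Frechet derivatives\<close>

lemma has_derivative_fderiv:
  assumes "f differentiable (at x)"
  shows "(f has_derivative blinfun_apply (fderiv f x)) (at x)"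
proof -
  have *: "(f has_derivative frechet_derivative f (at x)) (at x)"
    using assms frechet_derivative_works by blast
  then have "blinfun_apply (fderiv f x) = frechet_derivative f (at x)"
    unfolding fderiv_def by (intro bounded_linear_Blinfun_apply has_derivative_bounded_linear)
  with * show ?thesis by simp
qed

lemma fderiv_eqI:
  assumes "(f has_derivative blinfun_apply f') (at x)"
  shows "fderiv f x = f'"
  using frechet_derivative_at[OF assms, symmetric] by (simp add: fderiv_def blinfun_apply_inverse)

lemma fderiv_cong_open:
  assumes "open D" "x \<in> D" "\<And>z. z \<in> D \<Longrightarrow> F z = G z"
    and "(G has_derivative blinfun_apply G') (at x)"
  shows "F differentiable (at x)" "fderiv F x = G'"
proof -
  have *: "(F has_derivative blinfun_apply G') (at x)"
    by (rule has_derivative_transform_within_open[OF assms(4,1,2)]) (simp add: assms(3))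
  then show "F differentiable (at x)" "fderiv F x = G'"
    by (auto simp: differentiable_def intro: fderiv_eqI)
qed

text \<open>Since \<open>fderiv\<close> is a total function with junk values, it does not commute with sums everywhere. An
  explicit candidate for each derivative on an open set avoids this: once the candidates form a
  chain, \<open>fderiv\<close> must agree with them there.\<close>

definition deriv_chain where
  "deriv_chain D f f1 f2 f3 f4 \<longleftrightarrow>
     (\<forall>x\<in>D. (f has_derivative blinfun_apply (f1 x)) (at x)
          \<and> (f1 has_derivative blinfun_apply (f2 x)) (at x)
          \<and> (f2 has_derivative blinfun_apply (f3 x)) (at x)
          \<and> (f3 has_derivative blinfun_apply (f4 x)) (at x))"

lemma C4_on_imp_deriv_chain:
  "C4_on D f \<Longrightarrow> deriv_chain D f (fderiv f) (fderiv (fderiv f))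
     (fderiv (fderiv (fderiv f))) (fderiv (fderiv (fderiv (fderiv f))))"
  unfolding C4_on_def deriv_chain_def by (auto intro: has_derivative_fderiv)

text \<open>Each derivative is known only on \<open>D\<close>, but \<open>D\<close> is open, so this determines the next one.\<close>

lemma deriv_chain_fderiv:
  assumes "open D" "deriv_chain D f f1 f2 f3 f4" "x \<in> D"
  shows "f differentiable (at x) \<and> fderiv f x = f1 x"
    and "fderiv f differentiable (at x) \<and> fderiv (fderiv f) x = f2 x"
    and "fderiv (fderiv f) differentiable (at x) \<and> fderiv (fderiv (fderiv f)) x = f3 x"
    and "fderiv (fderiv (fderiv f)) differentiable (at x)
      \<and> fderiv (fderiv (fderiv (fderiv f))) x = f4 x"
proof -
  have *: "(f has_derivative blinfun_apply (f1 z)) (at z)"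
    "(f1 has_derivative blinfun_apply (f2 z)) (at z)"
    "(f2 has_derivative blinfun_apply (f3 z)) (at z)"
    "(f3 has_derivative blinfun_apply (f4 z)) (at z)" if "z \<in> D" for z
    using assms(2) that unfolding deriv_chain_def by auto
  have 1: "f differentiable (at z) \<and> fderiv f z = f1 z" if "z \<in> D" for z
    using *(1)[OF that] by (auto simp: differentiable_def intro: fderiv_eqI)
  have 2: "fderiv f differentiable (at z) \<and> fderiv (fderiv f) z = f2 z" if "z \<in> D" for z
    using fderiv_cong_open[OF assms(1) that _ *(2)[OF that], of "fderiv f"] 1 by blast
  have 3: "fderiv (fderiv f) differentiable (at z) \<and> fderiv (fderiv (fderiv f)) z = f3 z"
    if "z \<in> D" for z
    using fderiv_cong_open[OF assms(1) that _ *(3)[OF that], of "fderiv (fderiv f)"] 2 by blast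
  have 4: "fderiv (fderiv (fderiv f)) differentiable (at z)
      \<and> fderiv (fderiv (fderiv (fderiv f))) z = f4 z" if "z \<in> D" for z
    using fderiv_cong_open[OF assms(1) that _ *(4)[OF that], of "fderiv (fderiv (fderiv f))"] 3
    by blast
  show "f differentiable (at x) \<and> fderiv f x = f1 x"
    "fderiv f differentiable (at x) \<and> fderiv (fderiv f) x = f2 x"
    "fderiv (fderiv f) differentiable (at x) \<and> fderiv (fderiv (fderiv f)) x = f3 x"
    "fderiv (fderiv (fderiv f)) differentiable (at x)
      \<and> fderiv (fderiv (fderiv (fderiv f))) x = f4 x"
    using 1 2 3 4 assms(3) by auto
qed

lemma deriv_chain_imp_C4_on:
  assumes "open D" "deriv_chain D f f1 f2 f3 f4" "continuous_on D f4"
  shows "C4_on D f"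
  using deriv_chain_fderiv[OF assms(1,2)] assms(3)
  unfolding C4_on_def by (auto cong: continuous_on_cong)

lemma deriv_chain_add:
  assumes "deriv_chain D f f1 f2 f3 f4" "deriv_chain D g g1 g2 g3 g4"
  shows "deriv_chain D (\<lambda>x. f x + g x) (\<lambda>x. f1 x + g1 x) (\<lambda>x. f2 x + g2 x)
    (\<lambda>x. f3 x + g3 x) (\<lambda>x. f4 x + g4 x)"
  using assms unfolding deriv_chain_def plus_blinfun.rep_eq
  by (auto intro!: has_derivative_add)

lemma deriv_chain_scale:
  assumes "deriv_chain D f f1 f2 f3 f4"
  shows "deriv_chain D (\<lambda>x. c *\<^sub>R f x) (\<lambda>x. c *\<^sub>R f1 x) (\<lambda>x. c *\<^sub>R f2 x)
    (\<lambda>x. c *\<^sub>R f3 x) (\<lambda>x. c *\<^sub>R f4 x)"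
  using assms unfolding deriv_chain_def scaleR_blinfun.rep_eq
  by (auto intro!: has_derivative_scaleR_right)

section \<open>The fourth power of the Euclidean norm\<close>

lemma blinfun_apply_Blinfun_linear:
  fixes f :: "'a::euclidean_space \<Rightarrow> 'b::real_normed_vector"
  assumes "linear f"
  shows "blinfun_apply (Blinfun f) = f"
  using assms by (simp add: bounded_linear_Blinfun_apply linear_conv_bounded_linear)

text \<open>The polarization of \<open>x \<mapsto> (B x x)\<^sup>2\<close>: full symmetry makes every derivative of
  \<open>x \<mapsto> T x x x x\<close> a numerical multiple of a contraction of \<open>T\<close>.\<close>

definition quartic_tensor ::
  "('a::euclidean_space \<Rightarrow>\<^sub>L 'a \<Rightarrow>\<^sub>L real) \<Rightarrow> 'a \<Rightarrow>\<^sub>L 'a \<Rightarrow>\<^sub>L 'a \<Rightarrow>\<^sub>L 'a \<Rightarrow>\<^sub>L real" where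
  "quartic_tensor B = Blinfun (\<lambda>w. Blinfun (\<lambda>h. Blinfun (\<lambda>k.
     (1/3) *\<^sub>R (B h k *\<^sub>R B w + B w k *\<^sub>R B h + B w h *\<^sub>R B k))))"

lemma quartic_tensor_apply:
  "blinfun_apply (blinfun_apply (blinfun_apply (quartic_tensor B) w) h) k =
     (1/3) *\<^sub>R (B h k *\<^sub>R B w + B w k *\<^sub>R B h + B w h *\<^sub>R B k)"
proof -
  define F where "F w h k = (1/3) *\<^sub>R (B h k *\<^sub>R B w + B w k *\<^sub>R B h + B w h *\<^sub>R B k)" for w h k
  define G where "G w h = Blinfun (F w h)" for w h
  have G: "blinfun_apply (G w h) = F w h" for w h
    unfolding G_def
    by (intro blinfun_apply_Blinfun_linear linearI blinfun_eqI)
       (auto simp: F_def blinfun.bilinear_simps algebra_simps)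
  define K where "K w = Blinfun (G w)" for w
  have K: "blinfun_apply (K w) = G w" for w
    unfolding K_def
    by (intro blinfun_apply_Blinfun_linear linearI blinfun_eqI)
       (auto simp: G F_def blinfun.bilinear_simps algebra_simps)
  have "blinfun_apply (Blinfun K) = K"
    by (intro blinfun_apply_Blinfun_linear linearI blinfun_eqI)
       (auto simp: K G F_def blinfun.bilinear_simps algebra_simps)
  moreover have "quartic_tensor B = Blinfun K"
    unfolding quartic_tensor_def K_def[abs_def] G_def[abs_def] F_def[abs_def] ..
  ultimately show ?thesis
    by (simp add: K G F_def)
qed

context
  fixes B :: "'a::euclidean_space \<Rightarrow>\<^sub>L 'a \<Rightarrow>\<^sub>L real"
  assumes B: "self_adjoint_pos_def B"
begin

lemma B_sym: "B x y = B y x"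
  using B unfolding self_adjoint_pos_def_def by blast

lemma B_nonneg: "0 \<le> B x x"
  using B unfolding self_adjoint_pos_def_def by (cases "x = 0") (auto simp: less_imp_le)

lemma norm_of_nonneg: "0 \<le> norm_of B x"
  by (simp add: norm_of_def B_nonneg)

lemma norm_of_pow4: "norm_of B x ^ 4 = (B x x)\<^sup>2"
proof -
  have "norm_of B x ^ 4 = ((norm_of B x)\<^sup>2)\<^sup>2"
    by (simp flip: power_mult)
  then show ?thesis
    by (simp add: norm_of_def B_nonneg)
qed

lemma norm_of_scaleR_pow4: "norm_of B (c *\<^sub>R x) ^ 4 = c ^ 4 * norm_of B x ^ 4"
  unfolding norm_of_pow4
  by (simp add: blinfun.scaleR_left blinfun.scaleR_right power2_eq_square power4_eq_xxxx)

lemma norm_of_minus_commute: "norm_of B (x - y) = norm_of B (y - x)"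
  by (simp add: norm_of_def blinfun.diff_left blinfun.diff_right)

lemma quartic_tensor_sym12: "quartic_tensor B w h = quartic_tensor B h w"
  by (rule blinfun_eqI) (simp add: quartic_tensor_apply B_sym[of w h] add_ac)

lemma quartic_tensor_sym23: "quartic_tensor B w h k = quartic_tensor B w k h"
  by (simp add: quartic_tensor_apply B_sym[of h k] add_ac)

lemma quartic_tensor_sym34: "quartic_tensor B w h k l = quartic_tensor B w h l k"
  by (simp add: quartic_tensor_apply blinfun.bilinear_simps B_sym[of k l] add_ac mult_ac)

lemma quartic_tensor_diag: "quartic_tensor B x x x x = norm_of B x ^ 4"
  by (simp add: quartic_tensor_apply norm_of_pow4 blinfun.bilinear_simps power2_eq_square)

lemma deriv_chain_norm_pow4:
  "deriv_chain D (\<lambda>x. norm_of B (x - c) ^ 4)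
     (\<lambda>x. 4 *\<^sub>R quartic_tensor B (x - c) (x - c) (x - c))
     (\<lambda>x. 12 *\<^sub>R quartic_tensor B (x - c) (x - c))
     (\<lambda>x. 24 *\<^sub>R quartic_tensor B (x - c))
     (\<lambda>x. 24 *\<^sub>R quartic_tensor B)"
  unfolding deriv_chain_def
proof (intro ballI)
  fix x
  let ?T = "quartic_tensor B"
  have id: "((\<lambda>x. x - c) has_derivative (\<lambda>h. h)) (at x)"
    by (auto intro!: derivative_eq_intros)
  have T1: "((\<lambda>x. ?T (x - c)) has_derivative ?T) (at x)"
    using bounded_linear.has_derivative[OF blinfun.bounded_linear_right[of ?T] id] .
  have T2: "((\<lambda>x. ?T (x - c) (x - c)) has_derivative blinfun_apply (2 *\<^sub>R ?T (x - c))) (at x)"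
  proof (rule has_derivative_eq_rhs[OF blinfun.FDERIV[OF T1 id]], rule ext)
    show "?T (x - c) h + ?T h (x - c) = (2 *\<^sub>R ?T (x - c)) h" for h
      using quartic_tensor_sym12[of h "x - c"] by (simp add: blinfun.bilinear_simps scaleR_2)
  qed
  have T3: "((\<lambda>x. ?T (x - c) (x - c) (x - c)) has_derivative
      blinfun_apply (3 *\<^sub>R ?T (x - c) (x - c))) (at x)"
  proof (rule has_derivative_eq_rhs[OF blinfun.FDERIV[OF T2 id]], rule ext)
    show "?T (x - c) (x - c) h + (2 *\<^sub>R ?T (x - c)) h (x - c) = (3 *\<^sub>R ?T (x - c) (x - c)) h" for h
      using quartic_tensor_sym23[of "x - c" h "x - c"]
        scaleR_add_left[of 1 2 "?T (x - c) (x - c) h"]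
      by (simp add: blinfun.scaleR_left)
  qed
  have T4: "((\<lambda>x. ?T (x - c) (x - c) (x - c) (x - c)) has_derivative
      blinfun_apply (4 *\<^sub>R ?T (x - c) (x - c) (x - c))) (at x)"
  proof (rule has_derivative_eq_rhs[OF blinfun.FDERIV[OF T3 id]], rule ext)
    show "?T (x - c) (x - c) (x - c) h + (3 *\<^sub>R ?T (x - c) (x - c)) h (x - c)
        = (4 *\<^sub>R ?T (x - c) (x - c) (x - c)) h" for h
      using quartic_tensor_sym34[of "x - c" "x - c" h "x - c"]
      by (simp add: blinfun.scaleR_left)
  qed
  show "((\<lambda>x. norm_of B (x - c) ^ 4) has_derivative
        blinfun_apply (4 *\<^sub>R ?T (x - c) (x - c) (x - c))) (at x)
    \<and> ((\<lambda>x. 4 *\<^sub>R ?T (x - c) (x - c) (x - c)) has_derivative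
        blinfun_apply (12 *\<^sub>R ?T (x - c) (x - c))) (at x)
    \<and> ((\<lambda>x. 12 *\<^sub>R ?T (x - c) (x - c)) has_derivative blinfun_apply (24 *\<^sub>R ?T (x - c))) (at x)
    \<and> ((\<lambda>x. 24 *\<^sub>R ?T (x - c)) has_derivative blinfun_apply (24 *\<^sub>R ?T)) (at x)"
    using T4 has_derivative_scaleR_right[OF T3, of 4] has_derivative_scaleR_right[OF T2, of 12]
      has_derivative_scaleR_right[OF T1, of 24]
    by (simp add: quartic_tensor_diag scaleR_blinfun.rep_eq)
qed

text \<open>Convexity is inherited first by the quadratic form and then by its square; in both steps the
  defect is \<open>t (1 - t)\<close> times a nonnegative quantity that can be written down.\<close>

lemma convex_norm_pow4:
  assumes "convex D"
  shows "convex_on D (\<lambda>x. norm_of B (x - c) ^ 4)"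
proof (rule convex_onI)
  fix t :: real and x y
  assume t: "0 < t" "t < 1"
  define p q where "p = x - c" and "q = y - c"
  have "B ((1 - t) *\<^sub>R p + t *\<^sub>R q) ((1 - t) *\<^sub>R p + t *\<^sub>R q)
      = (1 - t) * B p p + t * B q q - t * (1 - t) * B (p - q) (p - q)"
    using B_sym[of q p] by (simp add: blinfun.bilinear_simps algebra_simps)
  also have "\<dots> \<le> (1 - t) * B p p + t * B q q"
    using t B_nonneg[of "p - q"] by simp
  finally have "(B ((1 - t) *\<^sub>R p + t *\<^sub>R q) ((1 - t) *\<^sub>R p + t *\<^sub>R q))\<^sup>2
      \<le> ((1 - t) * B p p + t * B q q)\<^sup>2"
    using B_nonneg by (intro power_mono)
  also have "\<dots> = (1 - t) * (B p p)\<^sup>2 + t * (B q q)\<^sup>2 - t * (1 - t) * (B p p - B q q)\<^sup>2"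
    by (simp add: power2_eq_square algebra_simps)
  also have "\<dots> \<le> (1 - t) * (B p p)\<^sup>2 + t * (B q q)\<^sup>2"
    using t by simp
  finally have "norm_of B ((1 - t) *\<^sub>R p + t *\<^sub>R q) ^ 4
      \<le> (1 - t) * norm_of B p ^ 4 + t * norm_of B q ^ 4"
    by (simp add: norm_of_pow4)
  moreover have "(1 - t) *\<^sub>R x + t *\<^sub>R y - c = (1 - t) *\<^sub>R p + t *\<^sub>R q"
    by (simp add: p_def q_def algebra_simps)
  ultimately show "norm_of B ((1 - t) *\<^sub>R x + t *\<^sub>R y - c) ^ 4
      \<le> (1 - t) * norm_of B (x - c) ^ 4 + t * norm_of B (y - c) ^ 4"
    by (simp add: p_def q_def)
qed (rule assms)

lemma Q_regular_regularized:
  assumes f: "Q_regular B D f S 0 L" and H: "0 \<le> H"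
  shows "Q_regular B D (\<lambda>x. f x + H / 24 * norm_of B (x - c) ^ 4) S H (L + H)"
proof -
  let ?g = "\<lambda>x. f x + H / 24 * norm_of B (x - c) ^ 4"
  have D: "open D" "convex D" "convex S" "0 \<le> L" "C4_on D f" "half_extension S \<subseteq> D"
    and lo: "\<And>x h. x \<in> S \<Longrightarrow> 0 \<le> D4 f x h"
    and up: "\<And>x h. x \<in> half_extension S \<Longrightarrow> D4 f x h \<le> L * norm_of B h ^ 4"
    using f unfolding Q_regular_def by auto
  have SD: "S \<subseteq> D"
    using D(6) unfolding half_extension_def by force
  note chain = deriv_chain_add[OF C4_on_imp_deriv_chain[OF D(5)]
      deriv_chain_scale[OF deriv_chain_norm_pow4, of _ "H / 24" c], unfolded real_scaleR_def]
  have "continuous_on D (fderiv (fderiv (fderiv (fderiv f))))"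
    using D(5) unfolding C4_on_def by blast
  then have "C4_on D ?g"
    by (intro deriv_chain_imp_C4_on[OF D(1) chain] continuous_intros)
  moreover have "D4 ?g x h = D4 f x h + H * norm_of B h ^ 4" if "x \<in> D" for x h
    unfolding D4_def using deriv_chain_fderiv(4)[OF D(1) chain that]
    by (simp add: blinfun.bilinear_simps quartic_tensor_diag)
  ultimately show ?thesis
    unfolding Q_regular_def using D H lo up SD by (auto simp: distrib_right subset_iff)
qed

end

section \<open>One step of the method\<close>

lemma blinfun_along_line:
  assumes "f differentiable (at (x + t *\<^sub>R h))"
  shows "((\<lambda>t. f (x + t *\<^sub>R h)) has_vector_derivative fderiv f (x + t *\<^sub>R h) h) (at t)"
proof -
  have line: "((\<lambda>t. x + t *\<^sub>R h) has_derivative (\<lambda>s. s *\<^sub>R h)) (at t)"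
    by (auto intro!: derivative_eq_intros)
  show ?thesis
    using has_derivative_compose[OF line has_derivative_fderiv[OF assms]]
    by (simp add: has_vector_derivative_def blinfun.scaleR_right)
qed

lemma subset_half_extension: "S \<subseteq> half_extension S"
  unfolding half_extension_def by force

lemma segment_subset_half_extension:
  assumes "convex S" "x \<in> S" "y \<in> S" "t \<in> {-1/2..1}"
  shows "x + t *\<^sub>R (y - x) \<in> half_extension S"
proof -
  have segment: "x + s *\<^sub>R (y - x) \<in> S" if "s \<in> {0..1}" for s
    using convexD_alt[OF assms(1-3), of s] that by (simp add: algebra_simps)
  show ?thesis
  proof (cases "0 \<le> t")
    case True
    then show ?thesis
      using segment[of t] subset_half_extension assms(4) by auto
  next
    case False
    \<comment> \<open>\<open>x + t (y - x)\<close> is the reflected half step from \<open>x\<close> away from the point with parameter \<open>- 2 t\<close>\<close>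
    then have "x + (- 2 * t) *\<^sub>R (y - x) \<in> S"
      using assms(4) by (intro segment) auto
    moreover have "x + t *\<^sub>R (y - x) = x - (1/2) *\<^sub>R (x + (- 2 * t) *\<^sub>R (y - x) - x)"
      by simp
    ultimately show ?thesis
      unfolding half_extension_def using assms(2) by blast
  qed
qed

lemma convex_on_imp_second_deriv_nonneg:
  fixes f :: "real \<Rightarrow> real"
  assumes "open T" and convex: "convex_on T f" and "t \<in> T"
    and f': "\<And>s. s \<in> T \<Longrightarrow> (f has_real_derivative f' s) (at s)"
    and f'': "(f' has_real_derivative f'') (at t)"
  shows "0 \<le> f''"
proof (rule mono_on_imp_deriv_nonneg[OF _ f''])
  have tangent: "f' a * (b - a) \<le> f b - f a" if "a \<in> T" "b \<in> T" for a b
    using convex_on_imp_above_tangent[OF convex _ _ \<open>b \<in> T\<close>, of a "f' a"] that f' \<open>open T\<close>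
      convex_on_imp_convex[OF convex]
    by (auto simp: interior_open convex_connected intro: has_field_derivative_at_within)
  show "mono_on T f'"
  proof (rule mono_onI)
    fix a b assume ab: "a \<in> T" "b \<in> T" "a \<le> b"
    have "f' a * (b - a) \<le> f' b * (b - a)"
      using tangent[OF ab(1,2)] tangent[OF ab(2,1)] by (simp add: algebra_simps)
    then show "f' a \<le> f' b"
      using ab(3) by (cases "a = b") auto
  qed
qed (use assms in \<open>auto simp: interior_open\<close>)

lemma Q_regular_profile:
  assumes B: "self_adjoint_pos_def B" and g: "convex_on D g" "Q_regular B D g S \<mu> L"
    and xy: "x \<in> S" "y \<in> S" and h: "h = y - x"
  shows "quartic_profile (\<lambda>t. g (x + t *\<^sub>R h)) (\<lambda>t. fderiv g (x + t *\<^sub>R h) h)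
    (\<lambda>t. fderiv (fderiv g) (x + t *\<^sub>R h) h h) (\<lambda>t. fderiv (fderiv (fderiv g)) (x + t *\<^sub>R h) h h h)
    (\<lambda>t. D4 g (x + t *\<^sub>R h) h) (\<mu> * norm_of B h ^ 4) (L * norm_of B h ^ 4)"
proof -
  have D: "open D" "convex D" "convex S" "C4_on D g" "half_extension S \<subseteq> D"
    and lo: "\<And>x h. x \<in> S \<Longrightarrow> \<mu> * norm_of B h ^ 4 \<le> D4 g x h"
    and up: "\<And>x h. x \<in> half_extension S \<Longrightarrow> D4 g x h \<le> L * norm_of B h ^ 4"
    using g(2) unfolding Q_regular_def by auto
  have half: "x + t *\<^sub>R h \<in> half_extension S" if "t \<in> {-1/2..1}" for t
    using segment_subset_half_extension[OF D(3) xy that] by (simp add: h)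
  define T where "T = {t. x + t *\<^sub>R h \<in> D}"
  have T: "t \<in> T" if "t \<in> {-1/2..1}" for t
    using half[OF that] D(5) by (auto simp: T_def)
  have deriv: "((\<lambda>t. g (x + t *\<^sub>R h)) has_real_derivative fderiv g (x + t *\<^sub>R h) h) (at t)"
    "((\<lambda>t. fderiv g (x + t *\<^sub>R h) h) has_real_derivative
      fderiv (fderiv g) (x + t *\<^sub>R h) h h) (at t)"
    "((\<lambda>t. fderiv (fderiv g) (x + t *\<^sub>R h) h h) has_real_derivative
      fderiv (fderiv (fderiv g)) (x + t *\<^sub>R h) h h h) (at t)"
    "((\<lambda>t. fderiv (fderiv (fderiv g)) (x + t *\<^sub>R h) h h h) has_real_derivative
      D4 g (x + t *\<^sub>R h) h) (at t)" if "t \<in> T" for t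
    using that D(4) unfolding C4_on_def T_def D4_def has_real_derivative_iff_has_vector_derivative
    by (auto intro!: blinfun_along_line bounded_linear.has_vector_derivative[OF blinfun.bounded_linear_left])
  have "open T"
    unfolding T_def using open_vimage[OF D(1), of "\<lambda>t. x + t *\<^sub>R h"]
    by (simp add: vimage_def continuous_intros)
  have line: "x + (u * s + v * t) *\<^sub>R h = u *\<^sub>R (x + s *\<^sub>R h) + v *\<^sub>R (x + t *\<^sub>R h)"
    if "u + v = 1" for u v s t :: real
  proof -
    have "u *\<^sub>R (x + s *\<^sub>R h) + v *\<^sub>R (x + t *\<^sub>R h) = (u + v) *\<^sub>R x + (u * s + v * t) *\<^sub>R h"
      by (simp add: algebra_simps)
    then show ?thesis using that by simp
  qed
  have "convex_on T (\<lambda>t. g (x + t *\<^sub>R h))"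
    unfolding convex_on_def
  proof (intro conjI ballI allI impI)
    show "convex T"
      unfolding convex_def T_def using D(2) by (auto simp: line dest: convexD)
    fix s t u v :: real
    assume "s \<in> T" "t \<in> T" "0 \<le> u" "0 \<le> v" "u + v = 1"
    then show "g (x + (u *\<^sub>R s + v *\<^sub>R t) *\<^sub>R h) \<le> u * g (x + s *\<^sub>R h) + v * g (x + t *\<^sub>R h)"
      using g(1) by (simp add: line T_def convex_on_def)
  qed
  then have "0 \<le> fderiv (fderiv g) (x + t *\<^sub>R h) h h" if "t \<in> {-1/2..1}" for t
    using convex_on_imp_second_deriv_nonneg[OF \<open>open T\<close> _ T[OF that] deriv(1) deriv(2)[OF T[OF that]]]
    by blast
  moreover have "\<mu> * norm_of B h ^ 4 \<le> D4 g (x + t *\<^sub>R h) h" if "t \<in> {0..1}" for t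
    using convexD_alt[OF D(3) xy, of t] that by (intro lo) (simp add: h algebra_simps)
  ultimately show ?thesis
    by unfold_locales (use deriv T half up in auto)
qed

text \<open>The new point is compared with \<open>x + \<alpha> (z - x)\<close> inside the model, so the argument needs two
  profiles: towards \<open>y\<close> for the upper bound by the model, and towards \<open>z\<close> for its value at the
  comparison point.\<close>

lemma newton_step_contraction:
  assumes B: "self_adjoint_pos_def B" and g: "convex_on D g" "Q_regular B D g S \<mu> L"
    and P: "P \<subseteq> S" "convex_on P \<psi>" and "0 < \<mu>"
    and \<alpha>: "\<alpha> = 3/22 * (\<mu> / L) powr (1/3)" and \<gamma>: "\<gamma> = 1 / (3 * (1 - 2 * \<alpha>))"
    and x: "x \<in> P" and z: "z \<in> P" and y: "is_arg_min (quartic_model B g \<psi> L \<gamma> x) (\<lambda>y. y \<in> P) y"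
  shows "g y + \<psi> y - (g z + \<psi> z) \<le> (1 - \<alpha>) * (g x + \<psi> x - (g z + \<psi> z))"
proof -
  have \<mu>L: "\<mu> \<le> L" "0 < L"
    using g(2) \<open>0 < \<mu>\<close> unfolding Q_regular_def by auto
  have "(\<mu> / L) powr (1/3) \<le> 1"
    using \<mu>L \<open>0 < \<mu>\<close> by (intro powr_le1) auto
  then have \<alpha>_bounds: "0 < \<alpha>" "\<alpha> \<le> 3/22"
    using \<mu>L \<open>0 < \<mu>\<close> by (auto simp: \<alpha>)
  have "((\<mu> / L) powr (1/3)) ^ 3 = \<mu> / L"
    using \<mu>L \<open>0 < \<mu>\<close> by (simp add: powr_powr flip: powr_realpow)
  then have cube: "L * \<alpha> ^ 3 = (3/22) ^ 3 * \<mu>"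
    using \<mu>L unfolding \<alpha> power_mult_distrib by simp
  have \<gamma>_bounds: "0 < \<gamma>" "\<gamma> \<le> 1/2"
    using \<alpha>_bounds by (auto simp: \<gamma> field_simps)
  have yP: "y \<in> P" and ymin: "\<And>w. w \<in> P \<Longrightarrow> quartic_model B g \<psi> L \<gamma> x y \<le> quartic_model B g \<psi> L \<gamma> x w"
    using y by (auto simp: is_arg_min_linorder)
  have "g y + \<psi> y \<le> quartic_model B g \<psi> L \<gamma> x y"
  proof -
    interpret quartic_profile "\<lambda>t. g (x + t *\<^sub>R (y - x))" "\<lambda>t. fderiv g (x + t *\<^sub>R (y - x)) (y - x)"
      "\<lambda>t. fderiv (fderiv g) (x + t *\<^sub>R (y - x)) (y - x) (y - x)"
      "\<lambda>t. fderiv (fderiv (fderiv g)) (x + t *\<^sub>R (y - x)) (y - x) (y - x) (y - x)"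
      "\<lambda>t. D4 g (x + t *\<^sub>R (y - x)) (y - x)" "\<mu> * norm_of B (y - x) ^ 4" "L * norm_of B (y - x) ^ 4"
      using x yP P by (intro Q_regular_profile[OF B g]) auto
    show ?thesis
      using quartic_upper_model[OF \<gamma>_bounds] by (simp add: quartic_model_def)
  qed
  also have "\<dots> \<le> quartic_model B g \<psi> L \<gamma> x (x + \<alpha> *\<^sub>R (z - x))"
    using convexD_alt[OF convex_on_imp_convex[OF P(2)] x z, of \<alpha>] \<alpha>_bounds
    by (intro ymin) (simp add: algebra_simps)
  also have "\<dots> \<le> (1 - \<alpha>) * (g x + \<psi> x) + \<alpha> * (g z + \<psi> z)"
  proof -
    interpret quartic_profile "\<lambda>t. g (x + t *\<^sub>R (z - x))" "\<lambda>t. fderiv g (x + t *\<^sub>R (z - x)) (z - x)"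
      "\<lambda>t. fderiv (fderiv g) (x + t *\<^sub>R (z - x)) (z - x) (z - x)"
      "\<lambda>t. fderiv (fderiv (fderiv g)) (x + t *\<^sub>R (z - x)) (z - x) (z - x) (z - x)"
      "\<lambda>t. D4 g (x + t *\<^sub>R (z - x)) (z - x)" "\<mu> * norm_of B (z - x) ^ 4" "L * norm_of B (z - x) ^ 4"
      using x z P by (intro Q_regular_profile[OF B g]) auto
    have "0 \<le> \<mu> * norm_of B (z - x) ^ 4"
      using \<open>0 < \<mu>\<close> by simp
    moreover have "L * norm_of B (z - x) ^ 4 * \<alpha> ^ 3 = (3/22) ^ 3 * (\<mu> * norm_of B (z - x) ^ 4)"
      using arg_cong[OF cube, of "\<lambda>a. a * norm_of B (z - x) ^ 4"] by (simp add: mult_ac)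
    ultimately have "g x + \<alpha> * fderiv g x (z - x)
        + (1 + 3 * \<gamma>) / (6 * \<gamma>) * (\<alpha>\<^sup>2 * fderiv (fderiv g) x (z - x) (z - x))
        + (1 + 2 * \<gamma>) / 24 * (L * norm_of B (z - x) ^ 4 * \<alpha> ^ 4) \<le> (1 - \<alpha>) * g x + \<alpha> * g z"
      using interpolated_model[OF \<alpha>_bounds _ _ \<gamma>] by simp
    moreover have "\<psi> (x + \<alpha> *\<^sub>R (z - x)) \<le> (1 - \<alpha>) * \<psi> x + \<alpha> * \<psi> z"
      using convex_onD[OF P(2), of \<alpha> x z] x z \<alpha>_bounds by (simp add: algebra_simps)
    moreover have "quartic_model B g \<psi> L \<gamma> x (x + \<alpha> *\<^sub>R (z - x)) = g x + \<alpha> * fderiv g x (z - x)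
        + (1 + 3 * \<gamma>) / (6 * \<gamma>) * (\<alpha>\<^sup>2 * fderiv (fderiv g) x (z - x) (z - x))
        + (1 + 2 * \<gamma>) / 24 * (L * norm_of B (z - x) ^ 4 * \<alpha> ^ 4) + \<psi> (x + \<alpha> *\<^sub>R (z - x))"
      unfolding quartic_model_def
      by (simp add: blinfun.scaleR_right blinfun.scaleR_left norm_of_scaleR_pow4[OF B]
          power2_eq_square mult_ac)
    ultimately show ?thesis
      unfolding distrib_left by linarith
  qed
  finally show ?thesis
    by (simp add: algebra_simps)
qed

section \<open>Existence of a minimizer\<close>

lemma norm_of_bounds_norm:
  assumes B: "self_adjoint_pos_def B"
  obtains c where "c > 0" "\<And>z. c * norm z \<le> norm_of B z"
proof -
  have "continuous_on (sphere 0 1) (norm_of B)"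
    unfolding norm_of_def by (intro continuous_intros)
  moreover have "sphere (0::'a) 1 \<noteq> {}"
    by simp
  ultimately obtain z0 where z0: "z0 \<in> sphere 0 1"
    and min: "\<And>z. z \<in> sphere 0 1 \<Longrightarrow> norm_of B z0 \<le> norm_of B z"
    using continuous_attains_inf[of "sphere (0::'a) 1" "norm_of B"] by auto
  have "norm_of B z0 * norm z \<le> norm_of B z" for z
  proof (cases "z = 0")
    case False
    have "norm_of B z0 \<le> norm_of B ((1 / norm z) *\<^sub>R z)"
      using False by (intro min) simp
    also have "\<dots> = norm_of B z / norm z"
      by (simp add: norm_of_def blinfun.scaleR_left blinfun.scaleR_right real_sqrt_divide
          flip: real_sqrt_mult)
    finally show ?thesis
      using False by (simp add: field_simps)
  qed (simp add: norm_of_nonneg[OF B])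
  moreover have "0 < norm_of B z0"
  proof -
    have "z0 \<noteq> 0"
      using z0 by auto
    then show ?thesis
      using B by (simp add: norm_of_def self_adjoint_pos_def_def)
  qed
  ultimately show ?thesis
    using that by blast
qed

text \<open>Neither \<open>P\<close> nor \<open>D\<close> need be closed, so a limit point \<open>p\<close> of a minimizing sequence must be
  brought back into \<open>P\<close> before continuity of \<open>g\<close> can be used there. A tangent of \<open>g\<close> bounds \<open>g\<close>
  from below and hence \<open>\<psi>\<close> from above by some \<open>b\<close> along the bounded sequence; then \<open>(p, b)\<close> is in the
  closed epigraph of \<open>\<psi>\<close>. A second limit in the epigraph gives minimality.\<close>

lemma quartic_growth_attains_min:
  fixes B :: "'a::euclidean_space \<Rightarrow>\<^sub>L 'a \<Rightarrow>\<^sub>L real"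
  assumes B: "self_adjoint_pos_def B" and g: "convex_on D g" "Q_regular B D g S \<mu> L"
    and P: "P \<subseteq> S" "closed_convex_fun P \<psi>" "x0 \<in> P" and "0 < H"
    and growth: "\<And>x. x \<in> P \<Longrightarrow> a + H * norm_of B (x - x0) ^ 4 \<le> g x + \<psi> x"
  shows "\<exists>p. is_arg_min (\<lambda>x. g x + \<psi> x) (\<lambda>x. x \<in> P) p"
proof -
  define G where "G x = g x + \<psi> x" for x
  define m where "m = Inf (G ` P)"
  have "a \<le> G x" if "x \<in> P" for x
  proof -
    have "0 \<le> H * norm_of B (x - x0) ^ 4"
      using \<open>0 < H\<close> by simp
    then show ?thesis
      using growth[OF that] by (simp add: G_def)
  qed
  then have bdd: "bdd_below (G ` P)"
    by (intro bdd_belowI2[where m = a])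
  then have m_le: "m \<le> G x" if "x \<in> P" for x
    unfolding m_def using that by (intro cInf_lower) auto
  have "\<exists>x\<in>P. G x < m + inverse (Suc n)" for n
    using cInf_lessD[of "G ` P" "m + inverse (Suc n)"] P(3) by (auto simp: m_def)
  then obtain X where X: "\<And>n. X n \<in> P" "\<And>n. G (X n) < m + inverse (Suc n)"
    by metis
  have "(\<lambda>n. m + inverse (real (Suc n))) \<longlonglongrightarrow> m + 0"
    by (intro tendsto_intros LIMSEQ_inverse_real_of_nat)
  then have lim: "(\<lambda>n. m + inverse (real (Suc n))) \<longlonglongrightarrow> m"
    by simp
  have Gm: "(\<lambda>n. G (X n)) \<longlonglongrightarrow> m"
  proof (rule tendsto_sandwich[OF _ _ tendsto_const lim])
    show "\<forall>\<^sub>F n in sequentially. m \<le> G (X n)"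
      using m_le X(1) by simp
    show "\<forall>\<^sub>F n in sequentially. G (X n) \<le> m + inverse (real (Suc n))"
      using X(2) by (intro always_eventually allI less_imp_le) auto
  qed
  obtain c where c: "c > 0" "\<And>z. c * norm z \<le> norm_of B z"
    using norm_of_bounds_norm[OF B] by blast
  have "inverse (real (Suc n)) \<le> 1" for n
    by (simp add: field_simps)
  then have GX: "G (X n) \<le> m + 1" for n
    using X(2)[of n] by (smt (verit))
  define K where "K = max 1 ((m + 1 - a) / H) / c"
  have K: "norm (X n - x0) \<le> K" for n
  proof -
    define r where "r = c * norm (X n - x0)"
    \<comment> \<open>\<open>r\<close> is at most \<open>1\<close> or at most \<open>r ^ 4\<close>, which spares a fourth root\<close>
    have "r ^ 4 \<le> norm_of B (X n - x0) ^ 4"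
      using c by (intro power_mono) (auto simp: r_def)
    also have "\<dots> \<le> (m + 1 - a) / H"
      using growth[OF X(1), of n] GX[of n] \<open>0 < H\<close> by (simp add: G_def field_simps)
    finally have r: "r ^ 4 \<le> (m + 1 - a) / H" .
    have "r \<le> max 1 ((m + 1 - a) / H)"
    proof (cases "r \<le> 1")
      case False
      then have "r ^ 1 \<le> r ^ 4"
        by (intro power_increasing) auto
      with r show ?thesis by auto
    qed auto
    then show ?thesis
      using c(1) by (simp add: K_def r_def field_simps)
  qed
  have "norm (X n) \<le> K + norm x0" for n
    using K[of n] norm_triangle_sub[of "X n" x0] by simp
  then have "bounded (range X)"
    by (auto simp: bounded_iff)
  then obtain p r where r: "strict_mono r" and Xp: "(X \<circ> r) \<longlonglongrightarrow> p"
    using bounded_imp_convergent_subsequence by blast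
  have closed: "closed (epigraph P \<psi>)"
    using P(2) by (simp add: closed_convex_fun_def)
  have tangent: "g x0 + fderiv g x0 (x - x0) \<le> g x" if "x \<in> P" for x
  proof -
    interpret quartic_profile "\<lambda>t. g (x0 + t *\<^sub>R (x - x0))" "\<lambda>t. fderiv g (x0 + t *\<^sub>R (x - x0)) (x - x0)"
      "\<lambda>t. fderiv (fderiv g) (x0 + t *\<^sub>R (x - x0)) (x - x0) (x - x0)"
      "\<lambda>t. fderiv (fderiv (fderiv g)) (x0 + t *\<^sub>R (x - x0)) (x - x0) (x - x0) (x - x0)"
      "\<lambda>t. D4 g (x0 + t *\<^sub>R (x - x0)) (x - x0)" "\<mu> * norm_of B (x - x0) ^ 4" "L * norm_of B (x - x0) ^ 4"
      using that P by (intro Q_regular_profile[OF B g]) auto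
    show ?thesis
      using f''_imp_f'[of "{0..1}", OF _ d0 d1 nonneg, of 0 1] by simp
  qed
  define b where "b = m + 1 - g x0 + norm (fderiv g x0) * K"
  have "\<psi> (X n) \<le> b" for n
  proof -
    have "\<bar>fderiv g x0 (X n - x0)\<bar> \<le> norm (fderiv g x0) * norm (X n - x0)"
      using norm_blinfun[of "fderiv g x0" "X n - x0"] by simp
    also have "\<dots> \<le> norm (fderiv g x0) * K"
      by (intro mult_left_mono K) auto
    finally show ?thesis
      using tangent[OF X(1)[of n]] GX[of n] by (simp add: G_def b_def)
  qed
  then have "((X \<circ> r) n, b) \<in> epigraph P \<psi>" for n
    using X by (simp add: mem_epigraph)
  moreover have "(\<lambda>n. ((X \<circ> r) n, b)) \<longlonglongrightarrow> (p, b)"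
    by (intro tendsto_intros Xp)
  ultimately have "(p, b) \<in> epigraph P \<psi>"
    using closed_sequentially[OF closed, of "\<lambda>n. ((X \<circ> r) n, b)" "(p, b)"] by blast
  then have "p \<in> P"
    by (simp add: mem_epigraph)
  have "g differentiable (at p)"
    using g(2) \<open>p \<in> P\<close> P(1) subset_half_extension[of S]
    unfolding Q_regular_def C4_on_def by blast
  then have "isCont g p"
    by (rule differentiable_imp_continuous_within)
  then have "(\<lambda>n. g ((X \<circ> r) n)) \<longlonglongrightarrow> g p"
    using Xp by (rule isCont_tendsto_compose)
  then have "(\<lambda>n. ((X \<circ> r) n, G ((X \<circ> r) n) - g ((X \<circ> r) n))) \<longlonglongrightarrow> (p, m - g p)"
    using LIMSEQ_subseq_LIMSEQ[OF Gm r] by (intro tendsto_intros Xp) (simp_all add: o_def)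
  moreover have "((X \<circ> r) n, G ((X \<circ> r) n) - g ((X \<circ> r) n)) \<in> epigraph P \<psi>" for n
    using X by (simp add: mem_epigraph G_def)
  ultimately have "(p, m - g p) \<in> epigraph P \<psi>"
    using closed_sequentially[OF closed, of "\<lambda>n. ((X \<circ> r) n, G ((X \<circ> r) n) - g ((X \<circ> r) n))"]
    by blast
  then have "G p \<le> m"
    by (simp add: mem_epigraph G_def)
  then have "\<forall>y. y \<in> P \<longrightarrow> G p \<le> G y"
    using m_le by fastforce
  with \<open>p \<in> P\<close> show ?thesis
    by (auto simp: is_arg_min_linorder G_def)
qed

section \<open>Complexity of the regularized method\<close>

theorem mainTheorem7:
  fixes B :: "'a::euclidean_space \<Rightarrow>\<^sub>L 'a \<Rightarrow>\<^sub>L real"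
    and D S P :: "'a set"
    and f \<psi> F g F\<^sub>H :: "'a \<Rightarrow> real"
    and x\<^sub>0 xstar :: 'a
    and L R \<epsilon> H q \<gamma> :: real
  assumes "self_adjoint_pos_def B"
    and "closed_convex_fun P \<psi>"
    and "convex_on D f"
    and "Q_regular B D f S 0 L"
    and "P \<subseteq> S"
    and "F = (\<lambda>x. f x + \<psi> x)"
    and "is_arg_min F (\<lambda>x. x \<in> P) xstar"
    and "x\<^sub>0 \<in> P" and "F x\<^sub>0 > F xstar"
    and "R > 0" and "norm_of B (x\<^sub>0 - xstar) \<le> R"
    and "\<epsilon> > 0"
    and "H = 12 * \<epsilon> / R ^ 4"
    and "g = (\<lambda>x. f x + H / 24 * norm_of B (x - x\<^sub>0) ^ 4)"
    and "F\<^sub>H = (\<lambda>x. F x + H / 24 * norm_of B (x - x\<^sub>0) ^ 4)"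
    and "q = H / (L + H)"
    and "\<gamma> = 1 / (3 * (1 - 3 / 11 * q powr (1 / 3)))"
  shows "convex_on D g \<and> Q_regular B D g S H (L + H)
    \<and> 1 / q = 1 + L * R ^ 4 / (12 * \<epsilon>)
    \<and> (\<exists>xmin. is_arg_min F\<^sub>H (\<lambda>x. x \<in> P) xmin
        \<and> (\<forall>x. quartic_newton_run B g P \<psi> (L + H) \<gamma> x\<^sub>0 x \<longrightarrow>
              (\<exists>k \<le> nat \<lceil>22 / 3 * (1 + L * R ^ 4 / (12 * \<epsilon>)) powr (1 / 3)
                            * ln (2 * (F x\<^sub>0 - F xstar) / \<epsilon>)\<rceil>.
                 x k \<in> P \<and> F\<^sub>H (x k) - F\<^sub>H xmin \<le> \<epsilon> / 2))
        \<and> (\<forall>xbar\<in>P. F\<^sub>H xbar - F\<^sub>H xmin \<le> \<epsilon> / 2 \<longrightarrow> F xbar - F xstar \<le> \<epsilon>))"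
proof -
  note B = assms(1) and \<psi> = assms(2) and f = assms(3,4) and PS = assms(5) and F = assms(6)
    and x\<^sub>0 = assms(8) and gap = assms(9) and R = assms(10,11) and \<epsilon> = assms(12) and H = assms(13)
    and g = assms(14) and F\<^sub>H = assms(15) and q = assms(16) and \<gamma> = assms(17)
  have xstar: "xstar \<in> P" "\<And>x. x \<in> P \<Longrightarrow> F xstar \<le> F x"
    using assms(7) by (auto simp: is_arg_min_linorder)
  have "0 \<le> L"
    using f(2) by (simp add: Q_regular_def)
  have "0 < H"
    using R \<epsilon> by (simp add: H)
  have g_Q: "Q_regular B D g S H (L + H)"
    unfolding g using \<open>0 < H\<close> by (intro Q_regular_regularized[OF B f(2)]) auto
  have g_convex: "convex_on D g"
    unfolding g using \<open>0 < H\<close> convex_on_imp_convex[OF f(1)]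
    by (intro convex_on_add[OF f(1)] convex_on_cmul convex_norm_pow4[OF B]) auto
  have inv_q: "1 / q = 1 + L * R ^ 4 / (12 * \<epsilon>)"
    using R \<epsilon> \<open>0 < H\<close> by (simp add: q H field_simps)
  have F\<^sub>H_g: "F\<^sub>H = (\<lambda>x. g x + \<psi> x)"
    by (simp add: F\<^sub>H g F add_ac)
  have F_le: "F x \<le> F\<^sub>H x" for x
    using \<open>0 < H\<close> by (simp add: F\<^sub>H)
  obtain xmin where xmin: "is_arg_min F\<^sub>H (\<lambda>x. x \<in> P) xmin"
  proof -
    have "F xstar + H / 24 * norm_of B (x - x\<^sub>0) ^ 4 \<le> g x + \<psi> x" if "x \<in> P" for x
      using xstar(2)[OF that] by (simp add: g F)
    then show ?thesis
      using quartic_growth_attains_min[OF B g_convex g_Q PS \<psi> x\<^sub>0, of "H / 24" "F xstar"] \<open>0 < H\<close> that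
      unfolding F\<^sub>H_g by auto
  qed
  then have xmin_P: "xmin \<in> P" and xmin_le: "\<And>x. x \<in> P \<Longrightarrow> F\<^sub>H xmin \<le> F\<^sub>H x"
    by (auto simp: is_arg_min_linorder)
  define \<alpha> where "\<alpha> = 3/22 * (H / (L + H)) powr (1/3)"
  have "0 < q"
    using \<open>0 \<le> L\<close> \<open>0 < H\<close> by (simp add: q)
  have \<gamma>_\<alpha>: "\<gamma> = 1 / (3 * (1 - 2 * \<alpha>))"
    by (simp add: \<gamma> \<alpha>_def q)
  have "q powr (1/3) \<le> 1"
    using \<open>0 \<le> L\<close> \<open>0 < H\<close> by (intro powr_le1) (auto simp: q)
  then have \<alpha>_bounds: "0 < \<alpha>" "\<alpha> \<le> 1"
    using \<open>0 < q\<close> by (auto simp: \<alpha>_def q)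
  define K where "K = nat \<lceil>22 / 3 * (1 + L * R ^ 4 / (12 * \<epsilon>)) powr (1 / 3)
      * ln (2 * (F x\<^sub>0 - F xstar) / \<epsilon>)\<rceil>"
  have rate: "22 / 3 * (1 + L * R ^ 4 / (12 * \<epsilon>)) powr (1 / 3) = 1 / \<alpha>"
    using \<open>0 < q\<close> by (simp add: \<alpha>_def powr_divide flip: inv_q q)
  have run: "x K \<in> P \<and> F\<^sub>H (x K) - F\<^sub>H xmin \<le> \<epsilon> / 2"
    if x: "quartic_newton_run B g P \<psi> (L + H) \<gamma> x\<^sub>0 x" for x
  proof -
    have x0: "x 0 = x\<^sub>0"
      and step: "\<And>k. is_arg_min (quartic_model B g \<psi> (L + H) \<gamma> (x k)) (\<lambda>y. y \<in> P) (x (Suc k))"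
      using x by (auto simp: quartic_newton_run_def)
    have xP: "x k \<in> P" for k
      using x0 x\<^sub>0 step by (cases k) (auto simp: is_arg_min_linorder)
    have "F\<^sub>H (x k) - F\<^sub>H xmin \<le> (1 - \<alpha>) ^ k * (F\<^sub>H x\<^sub>0 - F\<^sub>H xmin)" for k
    proof (induction k)
      case (Suc k)
      have "F\<^sub>H (x (Suc k)) - F\<^sub>H xmin \<le> (1 - \<alpha>) * (F\<^sub>H (x k) - F\<^sub>H xmin)"
        unfolding F\<^sub>H_g using \<psi>
        by (intro newton_step_contraction[OF B g_convex g_Q PS _ \<open>0 < H\<close> \<alpha>_def \<gamma>_\<alpha> xP xmin_P step])
           (simp add: closed_convex_fun_def)
      also have "\<dots> \<le> (1 - \<alpha>) * ((1 - \<alpha>) ^ k * (F\<^sub>H x\<^sub>0 - F\<^sub>H xmin))"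
        using Suc \<alpha>_bounds by (intro mult_left_mono) auto
      finally show ?case by simp
    qed (simp add: x0)
    then have "F\<^sub>H (x K) - F\<^sub>H xmin \<le> (1 - \<alpha>) ^ K * (F\<^sub>H x\<^sub>0 - F\<^sub>H xmin)" .
    also have "\<dots> \<le> exp (- \<alpha>) ^ K * (F x\<^sub>0 - F xstar)"
    proof (intro mult_mono power_mono)
      show "1 - \<alpha> \<le> exp (- \<alpha>)"
        using exp_ge_add_one_self[of "- \<alpha>"] by simp
      have "F\<^sub>H x\<^sub>0 = F x\<^sub>0"
        by (simp add: F\<^sub>H norm_of_def)
      then show "F\<^sub>H x\<^sub>0 - F\<^sub>H xmin \<le> F x\<^sub>0 - F xstar"
        using xstar(2)[OF xmin_P] F_le[of xmin] by simp
    qed (use \<alpha>_bounds xmin_le[OF x\<^sub>0] in auto)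
    also have "\<dots> \<le> \<epsilon> / (2 * (F x\<^sub>0 - F xstar)) * (F x\<^sub>0 - F xstar)"
    proof (rule mult_right_mono)
      have "1 / \<alpha> * ln (2 * (F x\<^sub>0 - F xstar) / \<epsilon>) \<le> real K"
        unfolding K_def rate by (rule real_nat_ceiling_ge)
      then have "ln (2 * (F x\<^sub>0 - F xstar) / \<epsilon>) \<le> \<alpha> * real K"
        using \<alpha>_bounds by (simp add: field_simps)
      then have "exp (- (\<alpha> * real K)) \<le> exp (- ln (2 * (F x\<^sub>0 - F xstar) / \<epsilon>))"
        by simp
      also have "\<dots> = \<epsilon> / (2 * (F x\<^sub>0 - F xstar))"
        using gap \<epsilon> by (simp add: exp_minus)
      finally show "exp (- \<alpha>) ^ K \<le> \<epsilon> / (2 * (F x\<^sub>0 - F xstar))"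
        by (simp add: mult.commute flip: exp_of_nat_mult)
    qed (use gap in simp)
    also have "\<dots> = \<epsilon> / 2"
    proof -
      have cancel: "\<epsilon> / (2 * d) * d = \<epsilon> / 2" if "0 < d" for d
        using that by simp
      show ?thesis
        by (rule cancel) (use gap in simp)
    qed
    finally show ?thesis
      using xP by simp
  qed
  have accurate: "F xbar - F xstar \<le> \<epsilon>" if "F\<^sub>H xbar - F\<^sub>H xmin \<le> \<epsilon> / 2" for xbar
  proof -
    have "norm_of B (xstar - x\<^sub>0) ^ 4 \<le> R ^ 4"
      using R norm_of_nonneg[OF B] by (intro power_mono) (auto simp: norm_of_minus_commute[OF B, of xstar])
    then have "H / 24 * norm_of B (xstar - x\<^sub>0) ^ 4 \<le> H / 24 * R ^ 4"
      using \<open>0 < H\<close> by (intro mult_left_mono) auto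
    also have "\<dots> = \<epsilon> / 2"
      using R by (simp add: H)
    finally have "F\<^sub>H xstar \<le> F xstar + \<epsilon> / 2"
      by (simp add: F\<^sub>H)
    then show ?thesis
      using F_le[of xbar] xmin_le[OF xstar(1)] that by linarith
  qed
  show ?thesis
    using g_convex g_Q inv_q xmin run accurate unfolding K_def by blast
qed

end
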